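(* Assume $\operatorname{cov}\mathcal{M}<\mathfrak{c}$. Then for every $s>0$ there exists a separable metric space $X$ with $\dim_H X\ge s$ and cardinality $|X|<\mathfrak{c}$; consequently there is no function (of any kind) from $X$ onto a non-degenerate interval of $\mathbb{R}$.
   Context: $\mathfrak{c}$ is the cardinality of the continuum, $\mathcal{M}$ is the collection of first category (meager) subsets of $\mathbb{R}$, and $\operatorname{cov}\mathcal{M}$ is the least cardinality of a family of first category subsets of $\mathbb{R}$ whose union is $\mathbb{R}$. $\dim_H$ denotes Hausdorff dimension. *)

theory Defs
  imports "HOL-Analysis.Analysis" "HOL-Library.Equipollence"
begin

definition nowhere_dense :: "real set \<Rightarrow> bool" where
  "nowhere_dense N \<longleftrightarrow> interior (closure N) = {}"

definition meager :: "real set \<Rightarrow> bool" where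
  "meager A \<longleftrightarrow> (\<exists>F. countable F \<and> (\<forall>N\<in>F. nowhere_dense N) \<and> A \<subseteq> \<Union>F)"

definition covM_less_continuum :: bool where
  "covM_less_continuum \<longleftrightarrow>
     (\<exists>F::real set set. (\<forall>A\<in>F. meager A) \<and> \<Union>F = UNIV \<and> F \<prec> (UNIV::real set))"

definition hdiam :: "'a metric \<Rightarrow> 'a set \<Rightarrow> real" where
  "hdiam m U = (if U = {} then 0 else Sup {mdist m x y | x y. x \<in> U \<and> y \<in> U})"

definition hausdorff_pre :: "'a metric \<Rightarrow> real \<Rightarrow> real \<Rightarrow> 'a set \<Rightarrow> ennreal" where
  "hausdorff_pre m s \<delta> A =
     (INF U \<in> {U :: nat \<Rightarrow> 'a set. A \<subseteq> (\<Union>n. U n) \<and>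
                 (\<forall>n. U n \<subseteq> mspace m \<and> (\<forall>x\<in>U n. \<forall>y\<in>U n. mdist m x y \<le> \<delta>))}.
        (\<Sum>n. ennreal (hdiam m (U n) powr s)))"

definition hausdorff_measure :: "'a metric \<Rightarrow> real \<Rightarrow> 'a set \<Rightarrow> ennreal" where
  "hausdorff_measure m s A = (SUP \<delta>\<in>{0<..}. hausdorff_pre m s \<delta> A)"

definition hausdorff_dim :: "'a metric \<Rightarrow> ereal" where
  "hausdorff_dim m = Inf (ereal ` {t. 0 < t \<and> hausdorff_measure m t (mspace m) = 0})"

end

theory Submission
  imports Defs
begin

text \<open>
  If every family of fewer than \<open>\<kappa>\<close> functions in \<open>\<nat>\<^sup>\<nat>\<close> is met by a single \<open>g\<close> (each member
  agrees with \<open>g\<close> somewhere), then fewer than \<open>\<kappa>\<close> nowhere dense sets do not cover the line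
  (Bartoszynski): \<open>g\<close> guesses the strategies that shrink an interval off each of them. So
  \<open>cov \<M> < \<cc>\<close> yields a family \<open>F\<close> of fewer than \<open>\<cc>\<close> functions that no \<open>g\<close> meets. Give \<open>F\<close> the
  distance \<open>(k + 1) powr (-1/s)\<close>, where \<open>k\<close> is the first place of difference. If sets \<open>U\<^sub>n\<close>,
  listed by decreasing diameter, have \<open>\<Sum> (diam U\<^sub>n)\<^sup>s < 1\<close>, then \<open>(diam U\<^sub>n)\<^sup>s < 1/(n + 1)\<close>, so
  all members of \<open>U\<^sub>n\<close> agree at \<open>n\<close>; hence a cover of \<open>F\<close> of this kind would define a \<open>g\<close>
  meeting all of \<open>F\<close>.
\<close>

section \<open>Cardinality\<close>

lemma countable_imp_lesspoll_uncountable: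
  assumes "countable A" "uncountable B"
  shows "A \<prec> B"
proof -
  have "A \<lesssim> (UNIV :: nat set)"
    using assms(1) by (auto simp: countable_def lepoll_def)
  also have "\<dots> \<lesssim> B"
    using uncountable_infinite[OF assms(2)] by (simp add: infinite_le_lepoll)
  finally show ?thesis
    using countable_eqpoll[OF assms(1) eqpoll_sym] assms(2) by (auto simp: lesspoll_def eqpoll_def)
qed

lemma lesspoll_UN_countable:
  assumes "A \<prec> B" "uncountable B" and countable: "\<And>a. a \<in> A \<Longrightarrow> countable (C a)"
  shows "(\<Union>a\<in>A. C a) \<prec> B"
proof (cases "finite A")
  case True
  then have "countable (\<Union>a\<in>A. C a)"
    using countable by (rule countable_UN[OF countable_finite])
  then show ?thesis
    using assms(2) by (rule countable_imp_lesspoll_uncountable)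
next
  case False
  have "C a \<lesssim> A" if "a \<in> A" for a
  proof -
    have "C a \<lesssim> (UNIV :: nat set)"
      using countable[OF that] by (auto simp: countable_def lepoll_def)
    also have "\<dots> \<lesssim> A"
      using False by (simp add: infinite_le_lepoll)
    finally show ?thesis .
  qed
  then have "(\<Union>a\<in>A. C a) \<lesssim> A"
    using card_of_UNION_ordLeq_infinite[OF False ordLeq_refl[OF card_of_Card_order], of C]
    by (simp add: lepoll_def card_of_ordLeq)
  then show ?thesis
    using assms(1) by (rule lesspoll_trans1)
qed

lemma image_neq_nondegenerate_interval:
  fixes f :: "'a \<Rightarrow> real"
  assumes "A \<prec> (UNIV :: real set)" "is_interval I" "\<exists>x\<in>I. \<exists>y\<in>I. x \<noteq> y"
  shows "f ` A \<noteq> I"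
proof
  assume "f ` A = I"
  obtain a b where ab: "a \<in> I" "b \<in> I" "a < b"
    using assms(3) by (metis linorder_neqE)
  have "I \<approx> (UNIV :: real set)"
    using mem_is_interval_1_I[OF assms(2) ab(1,2)] by (intro eqpoll_real_subset[OF ab(3)]) simp
  moreover have "I \<prec> (UNIV :: real set)"
    using image_lepoll assms(1) unfolding \<open>f ` A = I\<close>[symmetric] by (rule lesspoll_trans1)
  ultimately show False
    by (simp add: lesspoll_def)
qed

section \<open>Guessing functions\<close>

definition evasive :: "('i \<Rightarrow> nat \<Rightarrow> 'c) \<Rightarrow> 'i set \<Rightarrow> bool" where
  "evasive u A \<longleftrightarrow> (\<forall>g. \<exists>a\<in>A. \<forall>n. u a n \<noteq> g n)"

locale guessing =
  fixes \<kappa> :: "'k set"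
  assumes uncountable: "uncountable \<kappa>"
    and not_evasive: "F \<prec> \<kappa> \<Longrightarrow> \<not> evasive (\<lambda>f :: nat \<Rightarrow> nat. f) F"
begin

lemma guess:
  fixes u :: "'i \<Rightarrow> nat \<Rightarrow> 'c :: countable"
  assumes "A \<prec> \<kappa>"
  obtains g where "\<And>a. a \<in> A \<Longrightarrow> \<exists>n. u a n = g n"
proof -
  have "(\<lambda>a n. to_nat (u a n)) ` A \<prec> \<kappa>"
    using image_lepoll assms by (rule lesspoll_trans1)
  then obtain g where g: "\<And>a. a \<in> A \<Longrightarrow> \<exists>n. to_nat (u a n) = g n"
    using not_evasive[of "(\<lambda>a n. to_nat (u a n)) ` A"] unfolding evasive_def by auto
  show thesis
  proof (rule that)
    show "\<exists>n. u a n = from_nat (g n)" if "a \<in> A" for a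
      using g[OF that] by (metis from_nat_to_nat)
  qed
qed

end

lemma distinct_representatives:
  fixes S :: "nat \<Rightarrow> 'a set"
  assumes "infinite (UNIV :: 'a set)"
  obtains x where "inj x" "\<And>n. n < card (S n) \<Longrightarrow> x n \<in> S n"
proof -
  define S' where "S' n = (if n < card (S n) then S n else UNIV)" for n
  have "\<exists>y. y \<in> S' n - f ` {..<n}" for n and f :: "nat \<Rightarrow> 'a"
  proof -
    have "\<not> S' n \<subseteq> f ` {..<n}"
    proof
      assume sub: "S' n \<subseteq> f ` {..<n}"
      then have "finite (S' n)"
        by (rule finite_subset) simp
      moreover have "card (S' n) \<le> n"
        using surj_card_le[OF _ sub] by simp
      ultimately show False
        using assms by (auto simp: S'_def split: if_splits)
    qed
    then show ?thesis by blast
  qed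
  then have "\<exists>x. \<forall>n. x n \<in> S' n - x ` {..<n}"
    by (intro dependent_wellorder_choice) auto
  then obtain x where x: "\<And>n. x n \<in> S' n - x ` {..<n}"
    by blast
  have "inj x"
    using x by (intro linorder_injI) (metis DiffD2 imageI lessThan_iff)
  moreover have "x n \<in> S n" if "n < card (S n)" for n
    using x[of n] that by (simp add: S'_def)
  ultimately show thesis
    by (rule that)
qed

text \<open>At stage \<open>n\<close> one guesses \<open>n + 1\<close> values of the function at once; hence one of the places
  that are spoken about has not been used at an earlier stage.\<close>

lemma (in guessing) guess_on_infinite_sets:
  fixes u :: "'i \<Rightarrow> nat \<Rightarrow> 'c :: countable"
  assumes A: "A \<prec> \<kappa>" and inf: "\<And>a. a \<in> A \<Longrightarrow> infinite (X a)"
  obtains g where "\<And>a. a \<in> A \<Longrightarrow> \<exists>n\<in>X a. u a n = g n"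
proof -
  define places where "places a n = map (enumerate (X a)) [0..<Suc n]" for a n
  define block where "block a n = map (\<lambda>m. (m, u a m)) (places a n)" for a n
  obtain G where G: "\<And>a. a \<in> A \<Longrightarrow> \<exists>n. block a n = G n"
    using guess[OF A] by blast
  obtain x where x: "inj x" "\<And>n. n < card (fst ` set (G n)) \<Longrightarrow> x n \<in> fst ` set (G n)"
    using distinct_representatives[of "\<lambda>n. fst ` set (G n)"] by auto
  show thesis
  proof (rule that)
    fix a assume a: "a \<in> A"
    obtain n where n: "G n = block a n"
      using G[OF a] by metis
    have places: "fst ` set (G n) = set (places a n)"
      by (simp add: n block_def image_image)
    have "card (set (places a n)) = card {0..<Suc n}"
      unfolding places_def set_map set_upt
      by (intro card_image inj_on_subset[OF inj_enumerate[OF inf[OF a]]]) simp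
    then have x_n: "x n \<in> set (places a n)"
      using x(2)[of n] by (simp add: places)
    then have "u a (x n) = the (map_of (G (inv x (x n))) (x n))"
      using x(1) by (simp add: n block_def map_of_map_restrict)
    moreover have "x n \<in> X a"
      using x_n enumerate_in_set[OF inf[OF a]] by (auto simp: places_def)
    ultimately show "\<exists>m\<in>X a. u a m = the (map_of (G (inv x m)) m)"
      by blast
  qed
qed

lemma le_funpow_if_Suc_le:
  fixes h :: "'a :: order \<Rightarrow> 'a"
  assumes "mono h" "\<And>n. j (Suc n) \<le> h (j n)"
  shows "j n \<le> (h ^^ n) (j 0)"
proof (induction n)
  case (Suc n)
  have "j (Suc n) \<le> h (j n)" by (rule assms(2))
  also have "\<dots> \<le> h ((h ^^ n) (j 0))" by (rule monoD[OF assms(1) Suc])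
  finally show ?case by simp
qed simp

lemma (in guessing) guess_growth:
  fixes h :: "'i \<Rightarrow> nat \<Rightarrow> nat"
  assumes A: "A \<prec> \<kappa>" and mono: "\<And>a. a \<in> A \<Longrightarrow> mono (h a)"
  obtains j where "mono j" "\<And>a. a \<in> A \<Longrightarrow> infinite {n. h a (j n) \<le> j (Suc n)}"
proof -
  have "A \<times> (UNIV :: nat set) \<prec> \<kappa>"
    unfolding Sigma_def by (intro lesspoll_UN_countable[OF A uncountable]) simp
  then obtain g where g: "\<And>p. p \<in> A \<times> (UNIV :: nat set) \<Longrightarrow> \<exists>n. (h (fst p) ^^ n) (snd p) = g n"
    using guess[of _ "\<lambda>p n. (h (fst p) ^^ n) (snd p)"] by blast
  define j where "j n = (\<Sum>i\<le>n. Suc (g i))" for n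
  have g_less: "g n < j n" for n
    unfolding j_def using member_le_sum[of n "{..n}" "\<lambda>i. Suc (g i)"] by simp
  have mono_j: "mono j"
    by (rule monoI) (auto simp: j_def intro!: sum_mono2)
  show thesis
  proof (rule that[OF mono_j], rule notI)
    fix a assume a: "a \<in> A" and "finite {n. h a (j n) \<le> j (Suc n)}"
    then obtain N where N: "\<And>n. h a (j n) \<le> j (Suc n) \<Longrightarrow> n < N"
      by (auto simp: finite_nat_set_iff_bounded)
    have slow: "j (Suc (N + n)) \<le> h a (j (N + n))" for n
      using N[of "N + n"] by linarith
    obtain n where n: "(h a ^^ n) (j N) = g n"
      using g[of "(a, j N)"] a by auto
    have "j n \<le> j (N + n)"
      using mono_j by (simp add: monoD)
    also have "\<dots> \<le> (h a ^^ n) (j N)"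
      using le_funpow_if_Suc_le[OF mono[OF a], of "\<lambda>n. j (N + n)" n] slow by simp
    also have "\<dots> < j n"
      unfolding n by (rule g_less)
    finally show False by simp
  qed
qed

text \<open>The bound \<open>j\<close> on the stages of a play is fixed in advance, so that a guess for a strategy
  on \<open>{..j n}\<close> can be used without knowing the play so far.\<close>

lemma (in guessing) guess_strategy_blocks:
  fixes \<sigma> :: "'i \<Rightarrow> nat \<Rightarrow> nat"
  assumes A: "A \<prec> \<kappa>"
  obtains j :: "nat \<Rightarrow> nat" and \<tau> :: "nat \<Rightarrow> nat \<Rightarrow> nat"
  where "mono j" "\<And>a. a \<in> A \<Longrightarrow> \<exists>n. \<forall>m\<le>j n. \<tau> n m = \<sigma> a m \<and> \<sigma> a m \<le> j (Suc n)"
proof -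
  define h where "h a n = (\<Sum>m\<le>n. \<sigma> a m)" for a n
  have "mono (h a)" for a
    by (rule monoI) (auto simp: h_def intro!: sum_mono2)
  then obtain j where j: "mono j" "\<And>a. a \<in> A \<Longrightarrow> infinite {n. h a (j n) \<le> j (Suc n)}"
    using guess_growth[OF A] by blast
  have \<sigma>_le: "\<sigma> a m \<le> h a n" if "m \<le> n" for a m n
    unfolding h_def using member_le_sum[of m "{..n}" "\<sigma> a"] that by simp
  obtain g where g: "\<And>a. a \<in> A \<Longrightarrow>
      \<exists>n\<in>{n. h a (j n) \<le> j (Suc n)}. map (\<sigma> a) [0..<Suc (j n)] = g n"
    using guess_on_infinite_sets[OF A j(2), of "\<lambda>a. a" "\<lambda>a n. map (\<sigma> a) [0..<Suc (j n)]"] by blast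
  show thesis
  proof (rule that[OF j(1)])
    fix a assume "a \<in> A"
    then obtain n where n: "h a (j n) \<le> j (Suc n)" "g n = map (\<sigma> a) [0..<Suc (j n)]"
      using g by force
    have "g n ! m = \<sigma> a m \<and> \<sigma> a m \<le> j (Suc n)" if "m \<le> j n" for m
      using order_trans[OF \<sigma>_le[OF that] n(1)] that by (simp add: n(2) del: upt_Suc)
    then show "\<exists>n. \<forall>m\<le>j n. g n ! m = \<sigma> a m \<and> \<sigma> a m \<le> j (Suc n)"
      by blast
  qed
qed

lemma (in guessing) guess_chain:
  fixes \<sigma> :: "'i \<Rightarrow> nat \<Rightarrow> nat" and R :: "nat \<Rightarrow> nat \<Rightarrow> bool"
  assumes A: "A \<prec> \<kappa>" and R: "reflp R" "\<And>a m. a \<in> A \<Longrightarrow> R m (\<sigma> a m)"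
  obtains c where "\<And>n. R (c n) (c (Suc n))" "\<And>a. a \<in> A \<Longrightarrow> \<exists>n. c (Suc n) = \<sigma> a (c n)"
proof -
  obtain j \<tau> where j: "mono j"
    and \<tau>: "\<And>a. a \<in> A \<Longrightarrow> \<exists>n. \<forall>m\<le>j n. \<tau> n m = \<sigma> a m \<and> \<sigma> a m \<le> j (Suc n)"
    using guess_strategy_blocks[OF A] by blast
  define step where "step n m = (if R m (\<tau> n m) \<and> \<tau> n m \<le> j (Suc n) then \<tau> n m else m)" for n m
  define c where "c = rec_nat 0 step"
  have c_Suc: "c (Suc n) = step n (c n)" for n
    by (simp add: c_def)
  have c_le: "c n \<le> j n" for n
  proof (induction n)
    case (Suc n)
    then show ?case
      using monoD[OF j, of n "Suc n"] by (auto simp: c_Suc step_def)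
  qed (simp add: c_def)
  show thesis
  proof (rule that)
    show "R (c n) (c (Suc n))" for n
      using R(1) by (simp add: c_Suc step_def reflp_def)
    fix a assume a: "a \<in> A"
    then obtain n where "\<tau> n (c n) = \<sigma> a (c n)" "\<sigma> a (c n) \<le> j (Suc n)"
      using \<tau> c_le by blast
    then have "c (Suc n) = \<sigma> a (c n)"
      using R(2)[OF a] by (simp add: c_Suc step_def)
    then show "\<exists>n. c (Suc n) = \<sigma> a (c n)" ..
  qed
qed

section \<open>Guessing and category\<close>

lemma countable_compact_pseudobase:
  obtains b :: "nat \<Rightarrow> 'a :: {heine_borel, second_countable_topology} set"
  where "\<And>n. compact (b n)" "\<And>n. interior (b n) \<noteq> {}"
    "\<And>U. open U \<Longrightarrow> U \<noteq> {} \<Longrightarrow> \<exists>n. b n \<subseteq> U"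
proof -
  obtain D :: "'a set" where D: "countable D" "\<And>U. open U \<Longrightarrow> U \<noteq> {} \<Longrightarrow> \<exists>d\<in>D. d \<in> U"
    using countable_dense_setE by blast
  define b where "b n = (case prod_decode n of (i, k) \<Rightarrow> cball (from_nat_into D i) (1 / real (Suc k)))" for n
  show thesis
  proof (rule that)
    show "compact (b n)" for n
      by (simp add: b_def split: prod.split)
    show "interior (b n) \<noteq> {}" for n
    proof -
      obtain d k where b_n: "b n = cball d (1 / real (Suc k))"
        by (metis b_def case_prod_unfold)
      have "d \<in> interior (b n)"
        using interior_maximal[OF ball_subset_cball open_ball] unfolding b_n by force
      then show ?thesis by blast
    qed
    fix U :: "'a set" assume "open U" "U \<noteq> {}"
    then obtain y \<epsilon> where y: "0 < \<epsilon>" "ball y \<epsilon> \<subseteq> U"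
      using open_contains_ball by blast
    obtain k where k: "1 / real (Suc k) < \<epsilon> / 2"
      using nat_approx_posE[of "\<epsilon> / 2"] y(1) by auto
    obtain d where d: "d \<in> D" "dist y d < 1 / real (Suc k)"
      using D(2)[of "ball y (1 / real (Suc k))"] by auto
    obtain i where i: "from_nat_into D i = d"
      using from_nat_into_surj[OF D(1) d(1)] by blast
    have "cball d (1 / real (Suc k)) \<subseteq> ball y \<epsilon>"
      using d(2) k by (intro subsetI) (simp, metric)
    then have "b (prod_encode (i, k)) \<subseteq> U"
      using y(2) by (simp add: b_def i)
    then show "\<exists>n. b n \<subseteq> U" ..
  qed
qed

lemma (in guessing) Union_nowhere_dense_neq_UNIV:
  fixes K :: "'a :: {heine_borel, second_countable_topology} set set"
  assumes K: "K \<prec> \<kappa>" and nowhere_dense: "\<And>N. N \<in> K \<Longrightarrow> interior (closure N) = {}"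
  shows "\<Union>K \<noteq> UNIV"
proof -
  obtain b :: "nat \<Rightarrow> 'a set" where b: "\<And>n. compact (b n)" "\<And>n. interior (b n) \<noteq> {}"
    and small: "\<And>U. open U \<Longrightarrow> U \<noteq> {} \<Longrightarrow> \<exists>n. b n \<subseteq> U"
    using countable_compact_pseudobase by blast
  have "\<exists>k. b k \<subseteq> b m - N" if "N \<in> K" for N m
  proof -
    have "\<not> interior (b m) \<subseteq> closure N"
      using b(2) nowhere_dense[OF that] by (metis interior_maximal open_interior subset_empty)
    then obtain k where "b k \<subseteq> interior (b m) - closure N"
      using small[of "interior (b m) - closure N"] by (auto simp: open_Diff)
    also have "\<dots> \<subseteq> b m - N"
      using interior_subset closure_subset by blast
    finally show ?thesis ..
  qed
  then obtain \<sigma> where \<sigma>: "\<And>N m. N \<in> K \<Longrightarrow> b (\<sigma> N m) \<subseteq> b m - N"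
    by metis
  obtain c where c: "\<And>n. b (c (Suc n)) \<subseteq> b (c n)" "\<And>N. N \<in> K \<Longrightarrow> \<exists>n. c (Suc n) = \<sigma> N (c n)"
  proof (rule guess_chain[OF K])
    show "reflp (\<lambda>m k. b k \<subseteq> b m)"
      by (simp add: reflp_def)
    show "b (\<sigma> N m) \<subseteq> b m" if "N \<in> K" for N m
      using \<sigma>[OF that] by blast
  qed blast
  have "(\<Inter>n. b (c n)) \<noteq> {}"
  proof (rule compact_nest)
    show "compact (b (c n))" "b (c n) \<noteq> {}" for n
      using b by (blast, metis interior_empty)
    show "b (c n) \<subseteq> b (c m)" if "m \<le> n" for m n
      using lift_Suc_antimono_le[of "\<lambda>n. b (c n)", OF c(1) that] .
  qed
  then obtain y where y: "\<And>n. y \<in> b (c n)"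
    by blast
  have "y \<notin> N" if "N \<in> K" for N
    using c(2)[OF that] \<sigma>[OF that] y by (metis DiffE subsetD)
  then show ?thesis
    by blast
qed

lemma (in guessing) Union_meager_neq_UNIV:
  assumes F: "F \<prec> \<kappa>" and "\<And>A. A \<in> F \<Longrightarrow> meager A"
  shows "\<Union>F \<noteq> UNIV"
proof -
  obtain \<N> where \<N>: "\<And>A. A \<in> F \<Longrightarrow> countable (\<N> A)"
      "\<And>A N. A \<in> F \<Longrightarrow> N \<in> \<N> A \<Longrightarrow> nowhere_dense N" "\<And>A. A \<in> F \<Longrightarrow> A \<subseteq> \<Union>(\<N> A)"
    using assms(2) unfolding meager_def by metis
  have "\<Union>(\<Union>A\<in>F. \<N> A) \<noteq> UNIV"
    using \<N>(2) lesspoll_UN_countable[OF F uncountable \<N>(1)]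
    by (intro Union_nowhere_dense_neq_UNIV) (auto simp: nowhere_dense_def)
  then show ?thesis
    using \<N>(3) by blast
qed

lemma covM_less_continuum_imp_evasive:
  assumes covM_less_continuum
  obtains M :: "real set" and e :: "real \<Rightarrow> nat \<Rightarrow> nat"
  where "M \<prec> (UNIV :: real set)" "inj_on e M" "evasive e M"
proof -
  have "\<not> guessing (UNIV :: real set)"
    using assms guessing.Union_meager_neq_UNIV unfolding covM_less_continuum_def by metis
  then obtain F :: "(nat \<Rightarrow> nat) set" where F: "F \<prec> (UNIV :: real set)" "evasive (\<lambda>f. f) F"
    unfolding guessing_def using uncountable_UNIV_real by blast
  obtain \<iota> :: "(nat \<Rightarrow> nat) \<Rightarrow> real" where \<iota>: "inj_on \<iota> F"
    using F(1) unfolding lesspoll_def lepoll_def by blast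
  show thesis
  proof (rule that)
    show "\<iota> ` F \<prec> (UNIV :: real set)"
      using image_lepoll F(1) by (rule lesspoll_trans1)
    show "inj_on (inv_into F \<iota>) (\<iota> ` F)"
      by (rule inj_on_inv_into) simp
    show "evasive (inv_into F \<iota>) (\<iota> ` F)"
      using F(2) \<iota> by (simp add: evasive_def)
  qed
qed

section \<open>Hausdorff measure and dimension\<close>

lemma mdist_le_hdiam:
  assumes "\<And>x y. x \<in> U \<Longrightarrow> y \<in> U \<Longrightarrow> mdist m x y \<le> \<delta>" "x \<in> U" "y \<in> U"
  shows "mdist m x y \<le> hdiam m U"
proof -
  have "bdd_above {mdist m x y | x y. x \<in> U \<and> y \<in> U}"
    using assms(1) by (intro bdd_aboveI[of _ \<delta>]) auto
  then have "mdist m x y \<le> Sup {mdist m x y | x y. x \<in> U \<and> y \<in> U}"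
    using assms(2,3) by (intro cSup_upper) auto
  then show ?thesis
    using assms(2) by (auto simp: hdiam_def)
qed

lemma hausdorff_measure_zeroE:
  assumes "hausdorff_measure m t A = 0" "0 < \<delta>" "0 < \<epsilon>"
  obtains U :: "nat \<Rightarrow> 'a set"
  where "A \<subseteq> (\<Union>n. U n)" "\<And>n. U n \<subseteq> mspace m"
    "\<And>n x y. x \<in> U n \<Longrightarrow> y \<in> U n \<Longrightarrow> mdist m x y \<le> \<delta>"
    "summable (\<lambda>n. hdiam m (U n) powr t)" "(\<Sum>n. hdiam m (U n) powr t) < \<epsilon>"
proof -
  have "hausdorff_pre m t \<delta> A \<le> hausdorff_measure m t A"
    unfolding hausdorff_measure_def using assms(2) by (intro SUP_upper) simp
  also have "\<dots> < ennreal \<epsilon>"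
    using assms(1,3) by simp
  finally obtain U :: "nat \<Rightarrow> 'a set" where U: "A \<subseteq> (\<Union>n. U n)" "\<And>n. U n \<subseteq> mspace m"
      "\<And>n x y. x \<in> U n \<Longrightarrow> y \<in> U n \<Longrightarrow> mdist m x y \<le> \<delta>"
    and sum: "(\<Sum>n. ennreal (hdiam m (U n) powr t)) < ennreal \<epsilon>"
    unfolding hausdorff_pre_def Inf_less_iff by auto
  have summable: "summable (\<lambda>n. hdiam m (U n) powr t)"
    using sum by (intro summable_suminf_not_top) auto
  then have "(\<Sum>n. hdiam m (U n) powr t) < \<epsilon>"
    using sum by (simp add: suminf_ennreal2 ennreal_less_iff suminf_nonneg)
  with U summable show thesis
    by (rule that)
qed

lemma hausdorff_dim_ge:
  assumes "\<And>t. 0 < t \<Longrightarrow> t < s \<Longrightarrow> hausdorff_measure m t (mspace m) \<noteq> 0"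
  shows "ereal s \<le> hausdorff_dim m"
  unfolding hausdorff_dim_def using assms by (intro Inf_greatest) (force simp: not_less)

section \<open>The first-difference metric\<close>

definition branch_dist :: "real \<Rightarrow> (nat \<Rightarrow> 'c) \<Rightarrow> (nat \<Rightarrow> 'c) \<Rightarrow> real" where
  "branch_dist s x y = (if x = y then 0 else (1 + real (LEAST k. x k \<noteq> y k)) powr (- 1 / s))"

lemma branch_dist_nonneg: "0 \<le> branch_dist s x y"
  by (simp add: branch_dist_def)

lemma branch_dist_commute: "branch_dist s x y = branch_dist s y x"
  by (simp add: branch_dist_def eq_commute)

lemma branch_dist_eq_0_iff: "branch_dist s x y = 0 \<longleftrightarrow> x = y"
  by (simp add: branch_dist_def)

lemma branch_dist_le:
  assumes "s > 0" "\<And>i. i < k \<Longrightarrow> x i = y i"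
  shows "branch_dist s x y \<le> (1 + real k) powr (- 1 / s)"
proof (cases "x = y")
  case False
  then have "x (LEAST i. x i \<noteq> y i) \<noteq> y (LEAST i. x i \<noteq> y i)"
    by (intro LeastI_ex[of "\<lambda>i. x i \<noteq> y i"]) auto
  then have "k \<le> (LEAST i. x i \<noteq> y i)"
    using assms(2) by (meson linorder_not_less)
  then show ?thesis
    using False assms(1) by (simp add: branch_dist_def powr_mono2')
qed (simp add: branch_dist_def)

lemma branch_dist_ge:
  assumes "s > 0" "x k \<noteq> y k"
  shows "(1 + real k) powr (- 1 / s) \<le> branch_dist s x y"
proof -
  have "(LEAST i. x i \<noteq> y i) \<le> k"
    using assms(2) by (rule Least_le)
  moreover have "x \<noteq> y"
    using assms(2) by auto
  ultimately show ?thesis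
    using assms(1) by (simp add: branch_dist_def powr_mono2')
qed

lemma branch_dist_le_1: "s > 0 \<Longrightarrow> branch_dist s x y \<le> 1"
  using branch_dist_le[of s 0 x y] by simp

lemma branch_dist_ultrametric:
  assumes "s > 0"
  shows "branch_dist s x z \<le> max (branch_dist s x y) (branch_dist s y z)"
proof (cases "x = z")
  case True
  then show ?thesis
    by (simp add: branch_dist_commute branch_dist_def)
next
  case False
  define k where "k = (LEAST i. x i \<noteq> z i)"
  have "x k \<noteq> z k"
    unfolding k_def using False by (intro LeastI_ex[of "\<lambda>i. x i \<noteq> z i"]) auto
  then have "x k \<noteq> y k \<or> y k \<noteq> z k"
    by auto
  moreover have "branch_dist s x z = (1 + real k) powr (- 1 / s)"
    using False by (simp add: branch_dist_def k_def)
  ultimately show ?thesis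
    using branch_dist_ge[OF assms] unfolding le_max_iff_disj by metis
qed

locale branch_space =
  fixes s :: real and e :: "'a \<Rightarrow> nat \<Rightarrow> 'c" and M :: "'a set"
  assumes s_pos: "0 < s" and inj: "inj_on e M"

sublocale branch_space \<subseteq> Metric_space M "\<lambda>a b. branch_dist s (e a) (e b)"
proof
  fix a b c
  show "0 \<le> branch_dist s (e a) (e b)"
    by (rule branch_dist_nonneg)
  show "branch_dist s (e a) (e b) = branch_dist s (e b) (e a)"
    by (rule branch_dist_commute)
  show "branch_dist s (e a) (e b) = 0 \<longleftrightarrow> a = b" if "a \<in> M" "b \<in> M"
    using that inj by (simp add: branch_dist_eq_0_iff inj_on_eq_iff)
  show "branch_dist s (e a) (e c) \<le> branch_dist s (e a) (e b) + branch_dist s (e b) (e c)"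
    using branch_dist_ultrametric[OF s_pos, of "e a" "e c" "e b"]
      branch_dist_nonneg[of s "e a" "e b"] branch_dist_nonneg[of s "e b" "e c"] by linarith
qed

lemma countable_prefix_dense:
  fixes e :: "'a \<Rightarrow> nat \<Rightarrow> 'c :: countable"
  obtains C where "countable C" "C \<subseteq> M" "\<And>a k. a \<in> M \<Longrightarrow> \<exists>b\<in>C. \<forall>i<k. e a i = e b i"
proof -
  define prefix where "prefix k a = map (e a) [0..<k]" for k a
  have "\<exists>D. countable D \<and> D \<subseteq> M \<and> prefix k ` M = prefix k ` D" for k
    using countable_subset_image[of "prefix k ` M" "prefix k" M] by auto
  then obtain D where D: "\<And>k. countable (D k)" "\<And>k. D k \<subseteq> M" "\<And>k. prefix k ` M = prefix k ` D k"
    by metis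
  show thesis
  proof (rule that)
    show "countable (\<Union>k. D k)" "(\<Union>k. D k) \<subseteq> M"
      using D(1,2) by auto
    fix a k assume "a \<in> M"
    then obtain b where "b \<in> D k" "prefix k a = prefix k b"
      using D(3) by blast
    then show "\<exists>b\<in>\<Union>k. D k. \<forall>i<k. e a i = e b i"
      by (auto simp: prefix_def)
  qed
qed

lemma separable_branch_space:
  fixes e :: "'a \<Rightarrow> nat \<Rightarrow> 'c :: countable"
  assumes "branch_space s e M"
  shows "separable_space (Metric_space.mtopology M (\<lambda>a b. branch_dist s (e a) (e b)))"
proof -
  interpret branch_space s e M
    by (rule assms)
  obtain C where C: "countable C" "C \<subseteq> M" "\<And>a k. a \<in> M \<Longrightarrow> \<exists>b\<in>C. \<forall>i<k. e a i = e b i"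
    using countable_prefix_dense[of M e] by blast
  have "\<exists>b\<in>C. b \<in> mball a r" if a: "a \<in> M" and "0 < r" for a r
  proof -
    have "(\<lambda>k. (1 + real k) powr (- 1 / s)) \<longlonglongrightarrow> 0"
      using s_pos by real_asymp
    then have "\<forall>\<^sub>F k in sequentially. (1 + real k) powr (- 1 / s) < r"
      using \<open>0 < r\<close> by (rule order_tendstoD)
    then obtain k where k: "(1 + real k) powr (- 1 / s) < r"
      using eventually_happens'[OF sequentially_bot] by blast
    obtain b where b: "b \<in> C" "\<forall>i<k. e a i = e b i"
      using C(3)[OF a] by blast
    have "branch_dist s (e a) (e b) < r"
      using branch_dist_le[OF s_pos, of k "e a" "e b"] b(2) k by simp
    then show ?thesis
      using a b(1) C(2) by auto
  qed
  then have "mtopology closure_of C = M"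
    unfolding metric_closure_of by auto
  then show ?thesis
    using C(1,2) unfolding separable_space_def by auto
qed

lemma card_mult_less_suminf:
  fixes w :: "nat \<Rightarrow> real"
  assumes "\<And>i. 0 < w i" "summable w" "finite T" "\<And>j. j \<in> T \<Longrightarrow> c \<le> w j"
  shows "real (card T) * c < suminf w"
proof -
  obtain n where n: "T \<subseteq> {..<n}"
    using finite_nat_iff_bounded assms(3) by blast
  have "real (card T) * c \<le> sum w T"
    using assms(4) by (rule sum_bounded_below)
  also have "\<dots> \<le> sum w {..<n}"
    using n by (intro sum_mono2) (auto intro: less_imp_le[OF assms(1)])
  also have "\<dots> < suminf w"
    using assms(2,1) by (rule sum_less_suminf)
  finally show ?thesis .
qed

lemma inj_less_reciprocal_pos:
  fixes w :: "nat \<Rightarrow> real"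
  assumes pos: "\<And>i. 0 < w i" and summable: "summable w" and "suminf w \<le> 1"
  obtains r :: "nat \<Rightarrow> nat" where "inj r" "\<And>i. w i < 1 / (1 + real (r i))"
proof -
  define larger where "larger i = {j. w i < w j \<or> w j = w i \<and> j < i}" for i
  have fin: "finite (larger i)" for i
  proof -
    have "\<forall>\<^sub>F j in cofinite. w j < w i"
      unfolding cofinite_eq_sequentially
      by (rule order_tendstoD(2)[OF summable_LIMSEQ_zero[OF summable] pos])
    then have "finite {j. \<not> w j < w i}"
      by (simp add: eventually_cofinite)
    then show ?thesis
      by (rule finite_subset[rotated]) (auto simp: larger_def)
  qed
  have rank_less: "card (larger i) < card (larger j)" if "i \<in> larger j" for i j
  proof (rule psubset_card_mono[OF fin])
    show "larger i \<subset> larger j"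
      using that by (auto simp: larger_def)
  qed
  show thesis
  proof (rule that)
    show "inj (\<lambda>i. card (larger i))"
    proof (rule injI, rule ccontr)
      fix i j assume "card (larger i) = card (larger j)" "i \<noteq> j"
      moreover from \<open>i \<noteq> j\<close> have "i \<in> larger j \<or> j \<in> larger i"
        by (auto simp: larger_def)
      ultimately show False
        using rank_less by (metis less_irrefl)
    qed
    fix i
    have "real (card (insert i (larger i))) * w i < suminf w"
      using fin by (intro card_mult_less_suminf[OF pos summable]) (auto simp: larger_def)
    moreover have "i \<notin> larger i"
      by (simp add: larger_def)
    ultimately have "(1 + real (card (larger i))) * w i < 1"
      using fin assms(3) by simp
    then show "w i < 1 / (1 + real (card (larger i)))"
      by (simp add: field_simps)
  qed
qed

lemma inj_less_reciprocal:
  fixes w :: "nat \<Rightarrow> real"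
  assumes "\<And>i. 0 \<le> w i" "summable w" "suminf w < 1"
  obtains r :: "nat \<Rightarrow> nat" where "inj r" "\<And>i. w i < 1 / (1 + real (r i))"
proof -
  define v where "v i = w i + (1 - suminf w) * (1 / 2) ^ Suc i" for i
  have "v sums (suminf w + (1 - suminf w) * 1)"
    unfolding v_def using assms(2) by (intro sums_add sums_mult power_half_series summable_sums)
  then have v: "summable v" "suminf v \<le> 1"
    by (simp_all add: sums_iff)
  have w_less: "w i < v i" for i
    using assms(3) by (simp add: v_def)
  then have "0 < v i" for i
    using assms(1) by (rule le_less_trans[rotated])
  then obtain r where "inj r" "\<And>i. v i < 1 / (1 + real (r i))"
    using inj_less_reciprocal_pos v by blast
  then show thesis
    using w_less by (meson less_trans that)
qed

lemma not_evasive_if_cover: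
  assumes cover: "A \<subseteq> (\<Union>i. U i)" and r: "inj r"
    and const: "\<And>i a b. a \<in> U i \<Longrightarrow> b \<in> U i \<Longrightarrow> u a (r i) = u b (r i)"
  shows "\<not> evasive u A"
proof -
  define g where "g n = u (SOME a. a \<in> U (inv r n)) n" for n
  have "\<exists>n. u a n = g n" if "a \<in> A" for a
  proof -
    obtain i where i: "a \<in> U i"
      using cover \<open>a \<in> A\<close> by blast
    then have "(SOME a. a \<in> U i) \<in> U i"
      by (rule someI)
    then have "u a (r i) = g (r i)"
      unfolding g_def inv_f_f[OF r] by (rule const[OF i])
    then show ?thesis ..
  qed
  then show ?thesis
    unfolding evasive_def by metis
qed

context branch_space
begin

lemma agree_if_hdiam_less:
  assumes U: "a \<in> U" "b \<in> U" and t: "0 < t" "t \<le> s"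
    and small: "hdiam Self U powr t < 1 / (1 + real k)"
  shows "e a k = e b k"
proof (rule ccontr)
  assume "e a k \<noteq> e b k"
  then have "(1 + real k) powr (- 1 / s) \<le> branch_dist s (e a) (e b)"
    by (rule branch_dist_ge[OF s_pos])
  also have "\<dots> \<le> hdiam Self U"
    using mdist_le_hdiam[of U Self 1, OF _ U] by (simp add: branch_dist_le_1[OF s_pos])
  finally have diam: "(1 + real k) powr (- 1 / s) \<le> hdiam Self U" .
  have "1 / (1 + real k) = (1 + real k) powr (- 1)"
    by (simp add: powr_minus_divide)
  also have "\<dots> \<le> (1 + real k) powr (- 1 / s * t)"
    using t s_pos by (intro powr_mono) (simp_all add: field_simps)
  also have "\<dots> = ((1 + real k) powr (- 1 / s)) powr t"
    by (simp only: powr_powr)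
  also have "\<dots> \<le> hdiam Self U powr t"
    using diam t(1) by (intro powr_mono2) auto
  finally show False
    using small by simp
qed

lemma hausdorff_measure_neq_0_if_evasive:
  assumes "evasive e M" "0 < t" "t \<le> s"
  shows "hausdorff_measure Self t M \<noteq> 0"
proof
  assume "hausdorff_measure Self t M = 0"
  then obtain U :: "nat \<Rightarrow> 'a set" where U: "M \<subseteq> (\<Union>n. U n)"
    and sum: "summable (\<lambda>n. hdiam Self (U n) powr t)" "(\<Sum>n. hdiam Self (U n) powr t) < 1"
    by (rule hausdorff_measure_zeroE[of _ _ _ 1 1]) auto
  obtain r where r: "inj r" "\<And>n. hdiam Self (U n) powr t < 1 / (1 + real (r n))"
    using inj_less_reciprocal[OF _ sum] by auto
  have "\<not> evasive e M"
    using U r(1) agree_if_hdiam_less[OF _ _ assms(2,3) r(2)] by (rule not_evasive_if_cover)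
  then show False
    using assms(1) by contradiction
qed

lemma hausdorff_dim_ge_if_evasive: "evasive e M \<Longrightarrow> ereal s \<le> hausdorff_dim Self"
  using hausdorff_measure_neq_0_if_evasive by (intro hausdorff_dim_ge) simp

end

theorem theorem3p3:
  assumes "covM_less_continuum"
  shows "\<forall>s::real. s > 0 \<longrightarrow>
    (\<exists>m :: real metric.
        separable_space (mtopology_of m) \<and>
        hausdorff_dim m \<ge> ereal s \<and>
        mspace m \<prec> (UNIV :: real set) \<and>
        (\<forall>(f :: real \<Rightarrow> real) (I :: real set).
            is_interval I \<and> (\<exists>x\<in>I. \<exists>y\<in>I. x \<noteq> y) \<longrightarrow> f ` mspace m \<noteq> I))"
proof (intro allI impI)
  fix s :: real assume "s > 0"
  obtain M :: "real set" and e :: "real \<Rightarrow> nat \<Rightarrow> nat"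
    where M: "M \<prec> (UNIV :: real set)" "inj_on e M" "evasive e M"
    using covM_less_continuum_imp_evasive[OF assms] .
  interpret branch_space s e M
    by unfold_locales fact+
  show "\<exists>m :: real metric. separable_space (mtopology_of m) \<and> hausdorff_dim m \<ge> ereal s \<and>
      mspace m \<prec> (UNIV :: real set) \<and>
      (\<forall>(f :: real \<Rightarrow> real) (I :: real set).
          is_interval I \<and> (\<exists>x\<in>I. \<exists>y\<in>I. x \<noteq> y) \<longrightarrow> f ` mspace m \<noteq> I)"
  proof (intro exI[of _ Self] conjI allI impI)
    show "separable_space (mtopology_of Self)"
      unfolding mtopology_of_def mspace_Self mdist_Self
      by (rule separable_branch_space) unfold_locales
    show "ereal s \<le> hausdorff_dim Self"
      using M(3) by (rule hausdorff_dim_ge_if_evasive)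
    show "mspace Self \<prec> (UNIV :: real set)"
      using M(1) by simp
    show "f ` mspace Self \<noteq> I" if "is_interval I \<and> (\<exists>x\<in>I. \<exists>y\<in>I. x \<noteq> y)" for f :: "real \<Rightarrow> real" and I
      using image_neq_nondegenerate_interval[OF M(1)] that by simp
  qed
qed

end
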